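(* Let $K\subset\mathbb{R}^n$ be a convex body and let $\nu\in\mathbb{S}^{n-1}$. For any $p\in\mathbb{R}$ and any $u\in\nu^\perp$, define $$L(x,\lambda):=x\cdot u+\lambda(x\cdot\nu-p),\qquad x\in K,\ \lambda\in\mathbb{R}.$$ Then the slicing support function $h_\nu$ of $K$ satisfies $$h_\nu(u,p)=\sup_{x\in K}\inf_{\lambda\in\mathbb{R}}L(x,\lambda)=\inf_{\lambda\in\mathbb{R}}\sup_{x\in K}L(x,\lambda),$$ as identities in $[-\infty,\infty)$.
   Context: For a unit vector $\nu\in\mathbb{S}^{n-1}$ write $\nu^\perp=\{x\in\mathbb{R}^n: x\cdot\nu=0\}$, and for $p\in\mathbb{R}$ let $C(\nu,p)=K\cap\{x\in\mathbb{R}^n: x\cdot\nu=p\}$ (possibly empty). The slicing support function is $h_\nu(u,p)=\sup_{x\in C(\nu,p)}x\cdot u$ for $u\in\nu^\perp$, $p\in\mathbb{R}$, with the convention $h_\nu(u,p)=-\infty$ if $C(\nu,p)=\emptyset$. *)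

theory Defs
  imports "HOL-Analysis.Analysis"
begin

text \<open>Convex bodies need not have interior points; a full-dimensional body is a special case.\<close>

definition convex_body :: "(real ^ 'n) set \<Rightarrow> bool" where
  "convex_body K \<longleftrightarrow> K \<noteq> {} \<and> compact K \<and> convex K"

definition perp :: "real ^ 'n \<Rightarrow> (real ^ 'n) set" where
  "perp \<nu> = {x. x \<bullet> \<nu> = 0}"

definition slice :: "(real ^ 'n) set \<Rightarrow> real ^ 'n \<Rightarrow> real \<Rightarrow> (real ^ 'n) set" where
  "slice K \<nu> p = K \<inter> {x. x \<bullet> \<nu> = p}"

text \<open>The supremum is taken in the extended reals, where the empty supremum is \<open>-\<infinity>\<close>;
  this is the convention for empty slices.\<close>

definition slicing_support :: "(real ^ 'n) set \<Rightarrow> real ^ 'n \<Rightarrow> real ^ 'n \<Rightarrow> real \<Rightarrow> ereal" where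
  "slicing_support K \<nu> u p = (SUP x\<in>slice K \<nu> p. ereal (x \<bullet> u))"

definition lagrangian :: "real ^ 'n \<Rightarrow> real ^ 'n \<Rightarrow> real \<Rightarrow> real ^ 'n \<Rightarrow> real \<Rightarrow> real" where
  "lagrangian \<nu> u p x \<mu> = x \<bullet> u + \<mu> * (x \<bullet> \<nu> - p)"

end

theory Submission
  imports Defs
begin

text \<open>The minimax inequality \<open>inf sup \<le> sup inf\<close> is obtained by separating in the plane the compact
  convex set of pairs \<open>(x \<bullet> \<nu> - p, x \<bullet> u)\<close>, \<open>x \<in> K\<close>, from the vertical ray \<open>{0} \<times> [t, \<infinity>)\<close>, where
  \<open>t > h\<^sub>\<nu>(u, p)\<close>. The negated slope of a non-vertical separating line is the required multiplier. A
  vertical line means that the slice is empty, and then large multiples of its normal make the Lagrangian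
  arbitrarily small on \<open>K\<close>.\<close>

text \<open>A nonconstant affine function of \<open>\<mu>\<close> takes every real value, so its
  infimum lies below every real.\<close>

lemma INF_affine_ereal:
  fixes a b :: real
  shows "(INF \<mu>\<in>UNIV. ereal (a + \<mu> * b)) = (if b = 0 then ereal a else -\<infinity>)"
proof (cases "b = 0")
  case False
  have "(INF \<mu>\<in>UNIV. ereal (a + \<mu> * b)) \<le> ereal t" for t
  proof (rule INF_lower2)
    show "ereal (a + ((t - a) / b) * b) \<le> ereal t" using False by simp
  qed simp
  then have "(INF \<mu>\<in>UNIV. ereal (a + \<mu> * b)) = -\<infinity>"
    by (rule ereal_bot)
  with False show ?thesis by simp
qed simp

text \<open>The inner infimum acts as an exact penalty: it is \<open>x \<bullet> u\<close> on the
  slice and \<open>-\<infinity>\<close> off it, so points off the slice do not affect the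
  supremum.\<close>

lemma SUP_INF_lagrangian:
  "(SUP x\<in>K. INF \<mu>\<in>UNIV. ereal (lagrangian \<nu> u p x \<mu>)) = slicing_support K \<nu> u p"
proof -
  have "(SUP x\<in>K. if x \<bullet> \<nu> - p = 0 then ereal (x \<bullet> u) else -\<infinity>)
      = (SUP x\<in>slice K \<nu> p. ereal (x \<bullet> u))"
  proof (rule antisym; rule SUP_least)
    fix x assume "x \<in> K"
    then show "(if x \<bullet> \<nu> - p = 0 then ereal (x \<bullet> u) else -\<infinity>)
        \<le> (SUP x\<in>slice K \<nu> p. ereal (x \<bullet> u))"
      by (auto simp: slice_def intro!: SUP_upper)
  next
    fix x assume "x \<in> slice K \<nu> p"
    then show "ereal (x \<bullet> u)
        \<le> (SUP x\<in>K. if x \<bullet> \<nu> - p = 0 then ereal (x \<bullet> u) else -\<infinity>)"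
      by (intro SUP_upper2[of x]) (auto simp: slice_def)
  qed
  then show ?thesis
    by (simp only: lagrangian_def slicing_support_def INF_affine_ereal)
qed

lemma compact_inner_bounded:
  fixes K :: "'a::real_inner set"
  assumes "compact K"
  obtains B where "\<And>x. x \<in> K \<Longrightarrow> x \<bullet> u \<le> B"
proof -
  have "bounded ((\<lambda>x. x \<bullet> u) ` K)"
    by (intro compact_imp_bounded compact_continuous_image continuous_intros assms)
  then obtain B where "\<forall>x\<in>K. \<bar>x \<bullet> u\<bar> \<le> B"
    by (auto simp: bounded_iff)
  then show ?thesis
    using that[of B] by fastforce
qed

lemma ex_multiplier:
  assumes "convex_body K" and t: "\<And>x. x \<in> slice K \<nu> p \<Longrightarrow> x \<bullet> u < t"
  shows "\<exists>\<mu>. \<forall>x\<in>K. lagrangian \<nu> u p x \<mu> \<le> t"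
proof -
  have K: "K \<noteq> {}" "compact K" "convex K"
    using assms(1) by (auto simp: convex_body_def)
  define S where "S = (\<lambda>x. (x \<bullet> \<nu> - p, x \<bullet> u)) ` K"
  define R where "R = {0::real} \<times> {t..}"
  \<comment> \<open>Splitting the affine map into a linear map and a translation lets
    \<open>S\<close> inherit convexity from \<open>K\<close>.\<close>
  have "S = (+) (- p, 0) ` (\<lambda>x. (x \<bullet> \<nu>, x \<bullet> u)) ` K"
    by (auto simp: S_def image_image)
  moreover have "linear (\<lambda>x. (x \<bullet> \<nu>, x \<bullet> u))"
    by (auto intro!: linearI simp: inner_left_distrib)
  ultimately have "convex S"
    using K(3) by (simp only: convex_translation convex_linear_image)
  moreover have "compact S"
    unfolding S_def by (intro compact_continuous_image continuous_intros K)
  moreover have "S \<noteq> {}"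
    using K by (simp add: S_def)
  moreover have "convex R" "closed R"
    by (auto simp: R_def intro: convex_Times closed_Times)
  \<comment> \<open>A common point would come from an \<open>x\<close> in the slice with
    \<open>t \<le> x \<bullet> u\<close>, against the strict bound.\<close>
  moreover have "S \<inter> R = {}"
    using t by (force simp: S_def R_def slice_def)
  ultimately obtain a b where
    sep: "\<And>y. y \<in> S \<Longrightarrow> a \<bullet> y < b" "\<And>y. y \<in> R \<Longrightarrow> b < a \<bullet> y"
    using separating_hyperplane_compact_closed[of S R] by blast
  obtain a1 a2 where a: "a = (a1, a2)" by fastforce
  have S: "a1 * (x \<bullet> \<nu> - p) + a2 * (x \<bullet> u) < b" if "x \<in> K" for x
    using sep(1)[of "(x \<bullet> \<nu> - p, x \<bullet> u)"] that by (auto simp: S_def a)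
  have R: "b < a2 * s" if "t \<le> s" for s
    using sep(2)[of "(0, s)"] that by (auto simp: R_def a)
  \<comment> \<open>The ray is unbounded upwards: for negative \<open>a2\<close>, its point at
    height \<open>max t (b / a2)\<close> would violate the separation.\<close>
  have "0 \<le> a2"
  proof (rule ccontr)
    assume "\<not> 0 \<le> a2"
    then have "a2 * max t (b / a2) \<le> a2 * (b / a2)"
      by (intro mult_left_mono_neg) auto
    with R[of "max t (b / a2)"] \<open>\<not> 0 \<le> a2\<close> show False by simp
  qed
  then consider "a2 > 0" | "a2 = 0" by fastforce
  then show ?thesis
  proof cases
    case 1
    \<comment> \<open>The separating line is \<open>a1 * X + a2 * Y = b\<close>, of slope
      \<open>- a1 / a2\<close>. Its end of the ray gives \<open>b < a2 * t\<close>.\<close>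
    have "lagrangian \<nu> u p x (a1 / a2) \<le> t" if "x \<in> K" for x
    proof -
      have "a2 * lagrangian \<nu> u p x (a1 / a2) = a1 * (x \<bullet> \<nu> - p) + a2 * (x \<bullet> u)"
        using 1 by (simp add: lagrangian_def field_simps)
      also have "\<dots> < a2 * t"
        using S[OF that] R[of t] by simp
      finally show ?thesis using 1 by simp
    qed
    then show ?thesis by blast
  next
    case 2
    \<comment> \<open>Now \<open>a1 * (x \<bullet> \<nu> - p) < b < 0\<close> on all of
      \<open>K\<close>: the constraint term is bounded away from zero.\<close>
    have "b < 0" using R[of t] 2 by simp
    obtain B where B: "\<And>x. x \<in> K \<Longrightarrow> x \<bullet> u \<le> B"
      using compact_inner_bounded[OF K(2)] by blast
    \<comment> \<open>The multiple is chosen so that \<open>B + M * b \<le> t\<close>; taking it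
      nonnegative preserves the inequality being scaled.\<close>
    define M where "M = max 0 ((t - B) / b)"
    have "M * b \<le> t - B"
      using \<open>b < 0\<close> by (simp add: M_def max_def field_simps)
    moreover have "M * (a1 * (x \<bullet> \<nu> - p)) \<le> M * b" if "x \<in> K" for x
      using S[OF that] 2 by (intro mult_left_mono) (auto simp: M_def)
    ultimately have "lagrangian \<nu> u p x (M * a1) \<le> t" if "x \<in> K" for x
      using B[OF that] that by (fastforce simp: lagrangian_def mult.assoc)
    then show ?thesis by blast
  qed
qed

lemma INF_SUP_lagrangian_le:
  assumes "convex_body K"
  shows "(INF \<mu>\<in>UNIV. SUP x\<in>K. ereal (lagrangian \<nu> u p x \<mu>)) \<le> slicing_support K \<nu> u p"
\<comment> \<open>The infimum over \<open>\<mu>\<close> need not be attained, for instance when the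
  hyperplane is tangent to a disc. Comparing with each \<open>z\<close> strictly above the support
  value supplies the strict bound that \<open>ex_multiplier\<close> asks for.\<close>
proof (rule dense_ge)
  fix z assume z: "slicing_support K \<nu> u p < z"
  show "(INF \<mu>\<in>UNIV. SUP x\<in>K. ereal (lagrangian \<nu> u p x \<mu>)) \<le> z"
  proof (cases z)
    case (real t)
    have "x \<bullet> u < t" if "x \<in> slice K \<nu> p" for x
    proof -
      have "ereal (x \<bullet> u) \<le> slicing_support K \<nu> u p"
        unfolding slicing_support_def by (rule SUP_upper[OF that])
      also have "\<dots> < ereal t" using z real by simp
      finally show ?thesis by simp
    qed
    then obtain \<mu> where "\<forall>x\<in>K. lagrangian \<nu> u p x \<mu> \<le> t"
      using ex_multiplier[OF assms] by blast
    then show ?thesis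
      unfolding real by (intro INF_lower2[of \<mu>] SUP_least) auto
  qed (use z in auto)
qed

theorem proposition2:
  fixes K :: "(real ^ 'n) set" and \<nu> u :: "real ^ 'n" and p :: real
  assumes "convex_body K"
    and "\<nu> \<in> sphere 0 1"
    and "u \<in> perp \<nu>"
  shows "slicing_support K \<nu> u p = (SUP x\<in>K. INF \<mu>\<in>UNIV. ereal (lagrangian \<nu> u p x \<mu>))
    \<and> (SUP x\<in>K. INF \<mu>\<in>UNIV. ereal (lagrangian \<nu> u p x \<mu>))
        = (INF \<mu>\<in>UNIV. SUP x\<in>K. ereal (lagrangian \<nu> u p x \<mu>))
    \<and> slicing_support K \<nu> u p < \<infinity>"
proof (intro conjI)
  show "slicing_support K \<nu> u p = (SUP x\<in>K. INF \<mu>\<in>UNIV. ereal (lagrangian \<nu> u p x \<mu>))"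
    by (rule SUP_INF_lagrangian[symmetric])
  show "(SUP x\<in>K. INF \<mu>\<in>UNIV. ereal (lagrangian \<nu> u p x \<mu>))
      = (INF \<mu>\<in>UNIV. SUP x\<in>K. ereal (lagrangian \<nu> u p x \<mu>))"
  proof (rule antisym)
    show "(SUP x\<in>K. INF \<mu>\<in>UNIV. ereal (lagrangian \<nu> u p x \<mu>))
        \<le> (INF \<mu>\<in>UNIV. SUP x\<in>K. ereal (lagrangian \<nu> u p x \<mu>))"
      \<comment> \<open>Weak duality: both sides are compared through the single value of the
        Lagrangian at \<open>x\<close> and \<open>\<mu>\<close>.\<close>
      by (intro SUP_least INF_greatest) (blast intro: order_trans[OF INF_lower SUP_upper])
    show "(INF \<mu>\<in>UNIV. SUP x\<in>K. ereal (lagrangian \<nu> u p x \<mu>))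
        \<le> (SUP x\<in>K. INF \<mu>\<in>UNIV. ereal (lagrangian \<nu> u p x \<mu>))"
      unfolding SUP_INF_lagrangian by (rule INF_SUP_lagrangian_le[OF assms(1)])
  qed
  obtain B where "\<And>x. x \<in> K \<Longrightarrow> x \<bullet> u \<le> B"
    using assms(1) compact_inner_bounded unfolding convex_body_def by blast
  then have "slicing_support K \<nu> u p \<le> ereal B"
    unfolding slicing_support_def slice_def by (intro SUP_least) auto
  then show "slicing_support K \<nu> u p < \<infinity>"
    by (rule order_le_less_trans) simp
qed

end
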